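(* Let $p$ be a prime. (i) For every pair of integers $m>n>1$ there exists an integer $i_0=i_0(m,n,p)$ such that for all integers $i\geqslant i_0$, $$\operatorname{div}(\alpha_p(m,n,i))\geqslant\operatorname{div}(\mathbb{W}_{n(i+1)}(\mathbb{F}_p)).$$ (ii) For every pair of integers $m>n>1$, the least integer $i_0(m,n,p)$ with the property in (i) tends to infinity as the prime $p$ tends to infinity. (iii) For every integer $n>1$ there exists an integer $m_0=m_0(n,p)$ such that for all integers $m\geqslant m_0$ and all integers $i>0$, $$\operatorname{div}(\alpha_p(m,n,i))\geqslant\operatorname{div}(\mathbb{W}_{n(i+1)}(\mathbb{F}_p)).$$
   Context: $I_p$ is the set of positive integers not divisible by $p$. Under the canonical ring isomorphism $\mathbb{W}(\mathbb{F}_p)\cong\prod_{j\in I_p}\mathbb{Z}_p$, divisors of non-zero-divisors are identified with vectors in $\prod_{j\in I_p}\mathbb{Z}$ (the $p$-adic valuations of the components), and $\geqslant$ between divisors means componentwise $\geqslant$. Put $s_p(m,i,j)=\operatorname{card}(\{1,\dots,m(i+1)\}\cap\{j,pj,p^2j,\dots\})$. Then $\operatorname{div}(\mathbb{W}_{n(i+1)}(\mathbb{F}_p))$ is the vector $(s_p(n,i,j))_{j\in I_p}$, and $\alpha_p(m,n,i)\in\mathbb{W}(\mathbb{F}_p)$ is an element (determined up to a unit) with $\operatorname{div}(\alpha_p(m,n,i))=\sum_{0\leqslant h<i}\big(\operatorname{div}(\mathbb{W}_{m(h+1)}(\mathbb{F}_p))-\operatorname{div}(\mathbb{W}_{n(h+1)}(\mathbb{F}_p))\big)$,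 i.e. its $j$th component has $p$-adic valuation $\sum_{0\leqslant h<i}(s_p(m,h,j)-s_p(n,h,j))$. *)

theory Defs
  imports "HOL-Algebra.Ring" "HOL-Computational_Algebra.Primes"
begin

definition I_p :: "nat \<Rightarrow> nat set" where
  "I_p p = {j. 0 < j \<and> \<not> p dvd j}"

text \<open>\<open>\<int>\<^sub>p\<close> as the inverse limit of the rings \<open>\<int>/p\<^sup>k\<close>, each represented by its least nonnegative
  residues: the entry \<open>x k\<close> is the residue of \<open>x\<close> modulo \<open>p\<^sup>k\<close>.\<close>

definition padic_of_int :: "nat \<Rightarrow> int \<Rightarrow> nat \<Rightarrow> int" where
  "padic_of_int p a = (\<lambda>k. a mod int p ^ k)"

definition Zp :: "nat \<Rightarrow> (nat \<Rightarrow> int) ring" where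
  "Zp p = \<lparr>carrier = {x. \<forall>k. x k \<in> {0..<int p ^ k} \<and> x (Suc k) mod int p ^ k = x k},
     monoid.mult = (\<lambda>x y k. (x k * y k) mod int p ^ k),
     one = padic_of_int p 1,
     zero = padic_of_int p 0,
     add = (\<lambda>x y k. (x k + y k) mod int p ^ k)\<rparr>"

text \<open>The valuation is meaningful for nonzero \<open>x\<close> only.\<close>

definition padic_val :: "nat \<Rightarrow> (nat \<Rightarrow> int) \<Rightarrow> nat" where
  "padic_val p x =
     (GREATEST k. \<exists>y \<in> carrier (Zp p). x = padic_of_int p (int p ^ k) \<otimes>\<^bsub>Zp p\<^esub> y)"

text \<open>The ring of big Witt vectors \<open>\<W>(\<F>\<^sub>p)\<close>, in the form of the product of copies of \<open>\<int>\<^sub>p\<close> indexed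
  by \<open>I_p p\<close> to which it is canonically isomorphic.\<close>

definition Witt :: "nat \<Rightarrow> (nat \<Rightarrow> nat \<Rightarrow> int) ring" where
  "Witt p = \<lparr>carrier = (\<Pi>\<^sub>E j\<in>I_p p. carrier (Zp p)),
     monoid.mult = (\<lambda>a b. \<lambda>j\<in>I_p p. a j \<otimes>\<^bsub>Zp p\<^esub> b j),
     one = (\<lambda>j\<in>I_p p. \<one>\<^bsub>Zp p\<^esub>),
     zero = (\<lambda>j\<in>I_p p. \<zero>\<^bsub>Zp p\<^esub>),
     add = (\<lambda>a b. \<lambda>j\<in>I_p p. a j \<oplus>\<^bsub>Zp p\<^esub> b j)\<rparr>"

definition non_zero_divisors :: "('a, 'b) ring_scheme \<Rightarrow> 'a set" where
  "non_zero_divisors R =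
     {a \<in> carrier R. \<forall>b \<in> carrier R. a \<otimes>\<^bsub>R\<^esub> b = \<zero>\<^bsub>R\<^esub> \<longrightarrow> b = \<zero>\<^bsub>R\<^esub>}"

text \<open>Divisors are vectors of integers indexed by \<open>I_p p\<close>, represented by functions that are
  \<open>undefined\<close> outside \<open>I_p p\<close>.\<close>

definition div_elem :: "nat \<Rightarrow> (nat \<Rightarrow> nat \<Rightarrow> int) \<Rightarrow> nat \<Rightarrow> int" where
  "div_elem p a = (\<lambda>j\<in>I_p p. int (padic_val p (a j)))"

definition s_p :: "nat \<Rightarrow> nat \<Rightarrow> nat \<Rightarrow> nat \<Rightarrow> nat" where
  "s_p p m i j = card ({1..m * (i + 1)} \<inter> range (\<lambda>k. p ^ k * j))"

text \<open>\<open>div_Witt_trunc p n i\<close> is the divisor of \<open>\<W>\<^bsub>n(i+1)\<^esub>(\<F>\<^sub>p)\<close>; its entry at \<open>j\<close> is the length of the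
  \<open>j\<close>-th factor of this module over the product ring.\<close>

definition div_Witt_trunc :: "nat \<Rightarrow> nat \<Rightarrow> nat \<Rightarrow> nat \<Rightarrow> int" where
  "div_Witt_trunc p n i = (\<lambda>j\<in>I_p p. int (s_p p n i j))"

definition div_ge :: "nat \<Rightarrow> (nat \<Rightarrow> int) \<Rightarrow> (nat \<Rightarrow> int) \<Rightarrow> bool" where
  "div_ge p D E \<longleftrightarrow> (\<forall>j \<in> I_p p. D j \<ge> E j)"

text \<open>The element \<open>\<alpha>\<^sub>p(m,n,i)\<close> is determined only up to a unit, hence a predicate.\<close>

definition is_alpha :: "nat \<Rightarrow> nat \<Rightarrow> nat \<Rightarrow> nat \<Rightarrow> (nat \<Rightarrow> nat \<Rightarrow> int) \<Rightarrow> bool" where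
  "is_alpha p m n i a \<longleftrightarrow> a \<in> non_zero_divisors (Witt p) \<and>
     div_elem p a =
       (\<lambda>j\<in>I_p p. \<Sum>h<i. div_Witt_trunc p m h j - div_Witt_trunc p n h j)"


lemma padic_of_int_closed:
  assumes "p > 0"
  shows "padic_of_int p a \<in> carrier (Zp p)"
  using assms by (auto simp: Zp_def padic_of_int_def mod_mod_cancel)

lemma cring_Zp:
  assumes "p > 0"
  shows "cring (Zp p)"
proof -
  have red: "(u mod int p ^ Suc k) mod int p ^ k = u mod int p ^ k" for u k
    by (rule mod_mod_cancel) simp
  have fx: "x k mod int p ^ k = x k" if "x \<in> carrier (Zp p)" for x k
    using that by (simp add: Zp_def)
  have st: "x (Suc k) mod int p ^ k = x k" if "x \<in> carrier (Zp p)" for x k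
    using that by (simp add: Zp_def)
  have cl: "(\<lambda>k. f k mod int p ^ k) \<in> carrier (Zp p)"
    if "\<And>k. f (Suc k) mod int p ^ k = f k mod int p ^ k" for f
    using that assms red by (simp add: Zp_def del: power_Suc)
  have add: "x \<oplus>\<^bsub>Zp p\<^esub> y = (\<lambda>k. (x k + y k) mod int p ^ k)"
    and mul: "x \<otimes>\<^bsub>Zp p\<^esub> y = (\<lambda>k. (x k * y k) mod int p ^ k)"
    and one: "\<one>\<^bsub>Zp p\<^esub> = (\<lambda>k. 1 mod int p ^ k)" and zer: "\<zero>\<^bsub>Zp p\<^esub> = (\<lambda>k. 0)" for x y
    by (simp_all add: Zp_def padic_of_int_def)
  show ?thesis
  proof (intro cringI abelian_groupI comm_monoidI)
    fix x y assume x: "x \<in> carrier (Zp p)" and y: "y \<in> carrier (Zp p)"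
    show "x \<oplus>\<^bsub>Zp p\<^esub> y \<in> carrier (Zp p)"
      unfolding add by (rule cl) (metis st[OF x] st[OF y] mod_add_eq)
    show "x \<otimes>\<^bsub>Zp p\<^esub> y \<in> carrier (Zp p)"
      unfolding mul by (rule cl) (metis st[OF x] st[OF y] mod_mult_eq)
    show "x \<oplus>\<^bsub>Zp p\<^esub> y = y \<oplus>\<^bsub>Zp p\<^esub> x" "x \<otimes>\<^bsub>Zp p\<^esub> y = y \<otimes>\<^bsub>Zp p\<^esub> x"
      by (simp_all add: add mul ac_simps)
  next
    fix x assume x: "x \<in> carrier (Zp p)"
    show "\<zero>\<^bsub>Zp p\<^esub> \<oplus>\<^bsub>Zp p\<^esub> x = x" by (simp add: add zer fx[OF x])
    show "\<one>\<^bsub>Zp p\<^esub> \<otimes>\<^bsub>Zp p\<^esub> x = x" by (simp add: mul one mod_mult_left_eq fx[OF x])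
    have "(\<lambda>k. (- x k) mod int p ^ k) \<in> carrier (Zp p)"
      by (rule cl) (metis st[OF x] mod_minus_eq)
    moreover have "(\<lambda>k. (- x k) mod int p ^ k) \<oplus>\<^bsub>Zp p\<^esub> x = \<zero>\<^bsub>Zp p\<^esub>"
      by (simp add: add zer mod_add_left_eq)
    ultimately show "\<exists>y\<in>carrier (Zp p). y \<oplus>\<^bsub>Zp p\<^esub> x = \<zero>\<^bsub>Zp p\<^esub>" by blast
  next
    show "\<zero>\<^bsub>Zp p\<^esub> \<in> carrier (Zp p)" "\<one>\<^bsub>Zp p\<^esub> \<in> carrier (Zp p)"
      using padic_of_int_closed[OF assms] by (simp_all add: Zp_def)
  qed (simp_all add: add mul mod_simps, simp_all add: algebra_simps)
qed

lemma cring_Witt: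
  assumes "p > 0"
  shows "cring (Witt p)"
proof -
  interpret Z: cring "Zp p" by (rule cring_Zp) fact
  show ?thesis
  proof (intro cringI abelian_groupI comm_monoidI)
    fix a assume a: "a \<in> carrier (Witt p)"
    have "(\<lambda>j\<in>I_p p. \<ominus>\<^bsub>Zp p\<^esub> a j) \<in> carrier (Witt p)"
      using a by (auto simp: Witt_def)
    moreover have "(\<lambda>j\<in>I_p p. \<ominus>\<^bsub>Zp p\<^esub> a j) \<oplus>\<^bsub>Witt p\<^esub> a = \<zero>\<^bsub>Witt p\<^esub>"
      using a by (auto simp: Witt_def PiE_iff Z.l_neg intro!: restrict_ext)
    ultimately show "\<exists>b\<in>carrier (Witt p). b \<oplus>\<^bsub>Witt p\<^esub> a = \<zero>\<^bsub>Witt p\<^esub>" by blast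
    show "\<zero>\<^bsub>Witt p\<^esub> \<oplus>\<^bsub>Witt p\<^esub> a = a" "\<one>\<^bsub>Witt p\<^esub> \<otimes>\<^bsub>Witt p\<^esub> a = a"
      using a by (auto simp: Witt_def PiE_iff extensional_def)
  qed (auto simp: Witt_def PiE_iff Z.a_assoc Z.m_assoc Z.l_distr intro!: restrict_ext
         intro: Z.a_comm Z.m_comm)
qed

lemma padic_val_prime_power:
  assumes "prime p"
  shows "padic_val p (padic_of_int p (int p ^ v)) = v"
  unfolding padic_val_def
proof (rule Greatest_equality)
  have "p > 0" using assms by (simp add: prime_gt_0_nat)
  then show "\<exists>y\<in>carrier (Zp p). padic_of_int p (int p ^ v) = padic_of_int p (int p ^ v) \<otimes>\<^bsub>Zp p\<^esub> y"
    using padic_of_int_closed[of p 1]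
    by (intro bexI[of _ "padic_of_int p 1"]) (simp_all add: Zp_def padic_of_int_def mod_mult_eq)
next
  fix k
  assume "\<exists>y\<in>carrier (Zp p). padic_of_int p (int p ^ v) = padic_of_int p (int p ^ k) \<otimes>\<^bsub>Zp p\<^esub> y"
  then obtain y where "padic_of_int p (int p ^ v) = padic_of_int p (int p ^ k) \<otimes>\<^bsub>Zp p\<^esub> y" by blast
  from fun_cong[OF this, of "Suc v"]
  have eq: "int p ^ v mod int p ^ Suc v = (int p ^ k * y (Suc v)) mod int p ^ Suc v"
    by (simp add: Zp_def padic_of_int_def mod_mult_left_eq del: power_Suc)
  show "k \<le> v"
  proof (rule ccontr)
    assume "\<not> k \<le> v"
    then have "int p ^ Suc v dvd int p ^ k * y (Suc v)"
      by (intro dvd_mult2 le_imp_power_dvd) simp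
    with eq have "int p ^ Suc v dvd int p ^ v" by (simp add: dvd_eq_mod_eq_0 del: power_Suc)
    then show False
      using prime_gt_1_nat[OF assms] by (simp add: dvd_power_iff del: power_Suc)
  qed
qed

lemma ex_is_alpha:
  assumes "prime p" "n < m"
  shows "\<exists>a. is_alpha p m n i a"
proof -
  have p: "p > 0" using assms by (simp add: prime_gt_0_nat)
  have mono: "s_p p n h j \<le> s_p p m h j" for h j
    unfolding s_p_def using mult_le_mono1[OF less_imp_le[OF assms(2)], of "h + 1"]
    by (intro card_mono Int_mono) auto
  define v where "v j = (\<Sum>h<i. s_p p m h j - s_p p n h j)" for j
  define a where "a = (\<lambda>j\<in>I_p p. padic_of_int p (int p ^ v j))"
  have "a \<in> non_zero_divisors (Witt p)"
    unfolding non_zero_divisors_def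
  proof (intro CollectI conjI ballI impI)
    show "a \<in> carrier (Witt p)"
      using padic_of_int_closed[OF p] by (auto simp: a_def Witt_def)
    fix b assume b: "b \<in> carrier (Witt p)" and ab: "a \<otimes>\<^bsub>Witt p\<^esub> b = \<zero>\<^bsub>Witt p\<^esub>"
    have "b j k = 0" if j: "j \<in> I_p p" for j k
    proof -
      have bj: "b j \<in> carrier (Zp p)" using b j by (auto simp: Witt_def)
      have tower: "b j (k + l) mod int p ^ k = b j k" for l
      proof (induction l)
        case 0
        then show ?case using bj by (simp add: Zp_def)
      next
        case (Suc l)
        have "b j (k + Suc l) mod int p ^ k = (b j (Suc (k + l)) mod int p ^ (k + l)) mod int p ^ k"
          by (subst mod_mod_cancel) (auto intro: le_imp_power_dvd)
        also have "\<dots> = b j (k + l) mod int p ^ k" using bj by (simp add: Zp_def)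
        finally show ?case using Suc by simp
      qed
      have "(a \<otimes>\<^bsub>Witt p\<^esub> b) j (k + v j) = 0"
        using ab j by (simp add: Witt_def Zp_def padic_of_int_def)
      then have "(int p ^ v j * b j (k + v j)) mod int p ^ (k + v j) = 0"
        using j by (simp add: Witt_def Zp_def a_def padic_of_int_def mod_mult_left_eq)
      then have "int p ^ v j * int p ^ k dvd int p ^ v j * b j (k + v j)"
        by (metis mod_0_imp_dvd power_add add.commute)
      then have "int p ^ k dvd b j (k + v j)"
        using p by simp
      then show ?thesis using tower[of "v j"] by simp
    qed
    then show "b = \<zero>\<^bsub>Witt p\<^esub>"
      using b by (intro ext) (auto simp: Witt_def Zp_def padic_of_int_def PiE_iff extensional_def)
  qed
  moreover have "div_elem p a =
      (\<lambda>j\<in>I_p p. \<Sum>h<i. div_Witt_trunc p m h j - div_Witt_trunc p n h j)"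
    unfolding div_elem_def
    by (rule restrict_ext)
      (simp add: a_def padic_val_prime_power[OF assms(1)] v_def div_Witt_trunc_def of_nat_diff mono)
  ultimately show ?thesis unfolding is_alpha_def by blast
qed

end

theory Submission
  imports Defs
begin

text \<open>Counting pairs, the valuation of the \<open>j\<close>-th component of \<open>\<alpha>\<^sub>p(m,n,i)\<close> is the number of
  \<open>(h,k)\<close> with \<open>1 \<le> h \<le> i\<close> and \<open>n h < p\<^sup>k j \<le> m h\<close>. Let \<open>L\<close> be maximal with \<open>p\<^sup>L j \<le> n(i+1)\<close>, so that
  \<open>L + 1\<close> pairs are needed. For (i), every \<open>k \<le> L\<close> with \<open>p\<^sup>k j \<ge> n m\<close> supplies a pair, which leaves at
  most \<open>n m\<close> exceptions, and for large \<open>i\<close> the single exponent \<open>k = L\<close> supplies enough pairs to make up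
  for them. For (iii), if \<open>m \<ge> 2 n p\<^sup>n\<close> then each \<open>k\<close> from \<open>n\<close> to \<open>L + n\<close> supplies a pair. For (ii), if
  \<open>p > m i\<close> and \<open>j = 1\<close> then there are no pairs at all.\<close>

section \<open>Valuations as numbers of pairs\<close>

definition interval_pairs :: "nat \<Rightarrow> nat \<Rightarrow> nat \<Rightarrow> nat \<Rightarrow> nat \<Rightarrow> (nat \<times> nat) set" where
  "interval_pairs p m n i j =
     {(h, k). 1 \<le> h \<and> h \<le> i \<and> n * h < p ^ k * j \<and> p ^ k * j \<le> m * h}"

lemma less_power_mult:
  fixes p k j :: nat
  assumes "1 < p" "0 < j"
  shows "k < p ^ k * j"
proof -
  have "k < p ^ k" using assms(1) by (simp add: power_gt_expt)
  also have "\<dots> \<le> p ^ k * j" using assms(2) by simp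
  finally show ?thesis .
qed

lemma finite_powers_le:
  fixes p j x :: nat
  assumes "1 < p" "0 < j"
  shows "finite {k. p ^ k * j \<le> x}"
  by (rule finite_subset[of _ "{..<Suc x}"])
    (use less_power_mult[OF assms] in \<open>fastforce simp: less_Suc_eq_le intro: less_imp_le less_le_trans\<close>)+

lemma s_p_eq_card:
  assumes "1 < p" "0 < j"
  shows "s_p p m i j = card {k. p ^ k * j \<le> m * (i + 1)}"
proof -
  have "{1..m * (i + 1)} \<inter> range (\<lambda>k. p ^ k * j) = (\<lambda>k. p ^ k * j) ` {k. p ^ k * j \<le> m * (i + 1)}"
    using assms by (auto simp: Suc_le_eq)
  moreover have "inj_on (\<lambda>k. p ^ k * j) {k. p ^ k * j \<le> m * (i + 1)}"
    using assms by (auto simp: inj_on_def)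
  ultimately show ?thesis by (simp add: s_p_def card_image)
qed

text \<open>The first case arises when already \<open>j\<close> exceeds \<open>n * (i + 1)\<close>.
  Otherwise \<open>L\<close> is the largest admissible exponent, and all admissible ones lie in
  \<open>{..L}\<close>.\<close>

lemma s_p_cases:
  assumes "1 < p" "0 < j"
  obtains "s_p p n i j = 0"
  | L where "s_p p n i j \<le> L + 1" "p ^ L * j \<le> n * (i + 1)" "n * (i + 1) < p ^ (L + 1) * j"
proof (cases "{k. p ^ k * j \<le> n * (i + 1)} = {}")
  case True
  then have "s_p p n i j = 0" by (simp only: s_p_eq_card[OF assms] card.empty)
  then show thesis by (rule that(1))
next
  case False
  let ?K = "{k. p ^ k * j \<le> n * (i + 1)}"
  define L where "L = Max ?K"
  have fin: "finite ?K" by (rule finite_powers_le[OF assms])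
  have "L \<in> ?K" unfolding L_def using fin False by (rule Max_in)
  moreover have "L + 1 \<notin> ?K" using Max_ge[OF fin, of "L + 1"] by (auto simp: L_def)
  moreover have "?K \<subseteq> {..L}" using Max_ge[OF fin] by (auto simp: L_def)
  then have "card ?K \<le> L + 1" using card_mono[of "{..L}" ?K] by simp
  ultimately show thesis using that(2)[of L] by (simp add: s_p_eq_card[OF assms])
qed

lemma interval_pairs_eq_Sigma:
  "interval_pairs p m n i j =
     (SIGMA h:{1..i}. {k. p ^ k * j \<le> m * h} - {k. p ^ k * j \<le> n * h})"
  by (auto simp: interval_pairs_def)

lemma finite_interval_pairs:
  assumes "1 < p" "0 < j"
  shows "finite (interval_pairs p m n i j)"
  unfolding interval_pairs_eq_Sigma using finite_powers_le[OF assms] by auto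

text \<open>The summand at \<open>h\<close> counts the pairs whose first entry is
  \<open>h + 1\<close>, because \<open>s_p\<close> cuts off at multiples of \<open>h + 1\<close>;
  summing over these fibres counts all pairs.\<close>

lemma sum_s_p_diff_eq_card:
  assumes "1 < p" "0 < j" "n \<le> m"
  shows "(\<Sum>h<i. int (s_p p m h j) - int (s_p p n h j)) = int (card (interval_pairs p m n i j))"
proof -
  let ?D = "\<lambda>h. {k. p ^ k * j \<le> m * h} - {k. p ^ k * j \<le> n * h}"
  have "int (s_p p m h j) - int (s_p p n h j) = int (card (?D (Suc h)))" for h
  proof -
    have sub: "{k. p ^ k * j \<le> n * Suc h} \<subseteq> {k. p ^ k * j \<le> m * Suc h}"
      using mult_le_mono1[OF assms(3), of "Suc h"] by auto
    show ?thesis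
      using card_Diff_subset[OF finite_powers_le[OF assms(1,2)] sub]
        card_mono[OF finite_powers_le[OF assms(1,2)] sub]
      by (simp add: s_p_eq_card[OF assms(1,2)] of_nat_diff)
  qed
  then have "(\<Sum>h<i. int (s_p p m h j) - int (s_p p n h j)) = (\<Sum>h<i. int (card (?D (Suc h))))"
    by simp
  also have "\<dots> = (\<Sum>h\<in>{1..i}. int (card (?D h)))"
    by (simp add: sum.atLeast1_atMost_eq)
  also have "\<dots> = int (card (interval_pairs p m n i j))"
    unfolding interval_pairs_eq_Sigma
    using finite_powers_le[OF assms(1,2)] by (subst card_SigmaI) auto
  finally show ?thesis .
qed

text \<open>This removes \<alpha> and the Witt vectors: all three claims become inequalities between
  cardinalities.\<close>

lemma div_ge_alpha_iff:
  assumes "prime p" "n < m" "is_alpha p m n i a"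
  shows "div_ge p (div_elem p a) (div_Witt_trunc p n i) \<longleftrightarrow>
    (\<forall>j\<in>I_p p. s_p p n i j \<le> card (interval_pairs p m n i j))"
proof -
  have "div_elem p a j = int (card (interval_pairs p m n i j))" if "j \<in> I_p p" for j
  proof -
    have "div_elem p a j = (\<Sum>h<i. int (s_p p m h j) - int (s_p p n h j))"
      using assms(3) that by (simp add: is_alpha_def div_Witt_trunc_def)
    also have "\<dots> = int (card (interval_pairs p m n i j))"
      using assms that prime_gt_1_nat[OF assms(1)]
      by (intro sum_s_p_diff_eq_card) (auto simp: I_p_def)
    finally show ?thesis .
  qed
  then show ?thesis by (simp add: div_ge_def div_Witt_trunc_def)
qed

section \<open>Pairs for large \<open>i\<close>, part (i)\<close>

lemma le_mult_div_diff:
  fixes m n t x :: nat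
  assumes "0 < n" "n < m" "n * m * (1 + t) \<le> x"
  shows "x \<le> m * ((x - 1) div n - t)"
proof -
  \<comment> \<open>The largest \<open>h\<close> with \<open>n * h < x\<close>.\<close>
  define q where "q = (x - 1) div n"
  have x: "0 < x" using assms by (intro Nat.gr0I) auto
  have "x - 1 < n * (q + 1)"
    unfolding q_def using assms(1) dividend_less_div_times[of n "x - 1"]
    by (simp add: algebra_simps)
  with x have le: "x \<le> n * (q + 1)" by linarith
  have "n * (m * (1 + t)) \<le> n * (q + 1)"
    using assms(3) le by (simp only: mult.assoc)
  then have mt: "m * (1 + t) \<le> q + 1" using assms(1) mult_le_cancel1 by blast
  have "1 * (1 + t) \<le> m * (1 + t)" using assms(2) by (intro mult_le_mono1) simp
  also note mt
  finally have "t \<le> q" by simp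
  then obtain r where r: "q = r + t" by (metis add.commute le_Suc_ex)
  \<comment> \<open>As \<open>n + 1 \<le> m\<close>, the product \<open>m * (q + 1)\<close> exceeds
    \<open>x\<close> by at least \<open>q + 1\<close>, hence by \<open>m * (1 + t)\<close>, which is
    the cost of passing from \<open>q + 1\<close> to \<open>q - t\<close>.\<close>
  have "n * (q + 1) + (q + 1) \<le> m * (q + 1)"
    using mult_le_mono1[of "n + 1" m "q + 1"] assms(2) by (simp add: algebra_simps)
  then have "x + m * (1 + t) \<le> m * (q + 1)" using le mt by linarith
  also have "\<dots> = m * r + m * (1 + t)" by (simp add: r algebra_simps)
  finally have "x \<le> m * (q - t)" using r by simp
  then show ?thesis by (simp only: q_def)
qed

text \<open>Not only the largest \<open>h\<close> with \<open>n * h < p ^ k * j\<close> works but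
  also the one \<open>t\<close> below it, once \<open>p ^ k * j\<close> is large. The upper bound on
  \<open>p ^ k * j\<close> keeps \<open>h\<close> at most \<open>i\<close>.\<close>

lemma div_diff_mem_interval_pairs:
  assumes "0 < n" "n < m" "n * m * (1 + t) \<le> p ^ k * j" "p ^ k * j \<le> n * (i + 1)"
  shows "((p ^ k * j - 1) div n - t, k) \<in> interval_pairs p m n i j"
proof -
  let ?x = "p ^ k * j"
  define h where "h = (?x - 1) div n - t"
  have x: "0 < ?x" using assms(1-3) by (intro Nat.gr0I) auto
  have xm: "?x \<le> m * h" unfolding h_def by (rule le_mult_div_diff) fact+
  then have h: "1 \<le> h" using x by (cases h) auto
  have "n * h \<le> n * ((?x - 1) div n)" by (simp add: h_def)
  also have "\<dots> \<le> ?x - 1" by simp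
  finally have nh: "n * h < ?x" using x by linarith
  then have "n * h < n * (i + 1)" using assms(4) by linarith
  then have "h < i + 1" by (simp only: mult_less_cancel1)
  then have "h \<le> i" by simp
  with h nh xm show ?thesis by (simp add: interval_pairs_def h_def)
qed

lemma s_p_le_card_interval_pairs_large_i:
  assumes "1 < p" "0 < j" "0 < n" "n < m" "p * (n * m * (1 + n * m)) \<le> i"
  shows "s_p p n i j \<le> card (interval_pairs p m n i j)"
  using assms(1,2)
proof (cases rule: s_p_cases[of p j n i])
  case (2 L)
  \<comment> \<open>From exponent \<open>n * m\<close> on, \<open>k < p ^ k * j\<close> gives the
    size required for \<open>t = 0\<close>.\<close>
  define J where "J = n * m"
  define q where "q k = (p ^ k * j - 1) div n" for k
  let ?A = "(\<lambda>k. (q k, k)) ` {J..<L}" and ?B = "(\<lambda>t. (q L - t, L)) ` {..J}"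
  \<comment> \<open>Cancelling one factor \<open>p\<close> against \<open>p ^ (L + 1) * j\<close>
    will give the size required at exponent \<open>L\<close> for all
    \<open>t \<le> J\<close>.\<close>
  have "p * (n * m * (1 + J)) < n * (i + 1)"
  proof -
    have "1 * (i + 1) \<le> n * (i + 1)" using assms(3) by (intro mult_le_mono1) simp
    then have "i < n * (i + 1)" by (simp only: mult_1 Suc_eq_plus1[symmetric] Suc_le_eq)
    with assms(5) show ?thesis unfolding J_def by (rule le_less_trans)
  qed
  also note 2(3)
  finally have big: "n * m * (1 + J) \<le> p ^ L * j" by (simp add: mult.assoc)
  have A: "?A \<subseteq> interval_pairs p m n i j"
  proof clarify
    fix k assume k: "k \<in> {J..<L}"
    have "J \<le> p ^ k * j" using less_power_mult[OF assms(1,2), of k] k by simp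
    moreover have "p ^ k * j \<le> p ^ L * j" using k assms(1) by (intro mult_le_mono1 power_increasing) auto
    then have "p ^ k * j \<le> n * (i + 1)" using 2(2) by (rule le_trans)
    ultimately show "(q k, k) \<in> interval_pairs p m n i j"
      using div_diff_mem_interval_pairs[OF assms(3,4), of 0 p k j i] by (simp add: q_def J_def)
  qed
  have B: "(q L - t, L) \<in> interval_pairs p m n i j" if "t \<le> J" for t
  proof -
    have "n * m * (1 + t) \<le> n * m * (1 + J)" using that by simp
    also note big
    finally show ?thesis
      unfolding q_def using 2(2) by (rule div_diff_mem_interval_pairs[OF assms(3,4)])
  qed
  \<comment> \<open>This keeps the truncated differences \<open>q L - t\<close> distinct.\<close>
  have "J < q L"
  proof -
    have "1 \<le> q L - J" using B[of J] by (simp add: interval_pairs_def)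
    then show ?thesis by simp
  qed
  then have cB: "card ?B = J + 1" by (subst card_image) (auto simp: inj_on_def)
  have cA: "card ?A = L - J" by (subst card_image) (auto simp: inj_on_def)
  \<comment> \<open>The sum is \<open>(L - J) + (J + 1)\<close>; if \<open>L < J\<close>, then
    \<open>?A\<close> is empty and \<open>?B\<close> alone suffices.\<close>
  have "L + 1 \<le> card ?A + card ?B" using cA cB by simp
  also have "\<dots> = card (?A \<union> ?B)" by (subst card_Un_disjoint) auto
  also have "\<dots> \<le> card (interval_pairs p m n i j)"
    using A B by (intro card_mono finite_interval_pairs assms) auto
  finally show ?thesis using 2(1) by simp
qed simp

section \<open>Pairs for large \<open>m\<close>, part (iii)\<close>

lemma s_p_le_card_interval_pairs_large_m:
  assumes "1 < p" "0 < j" "0 < n" "0 < i" "2 * n * p ^ n \<le> m"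
  shows "s_p p n i j \<le> card (interval_pairs p m n i j)"
  using assms(1,2)
proof (cases rule: s_p_cases[of p j n i])
  case (2 L)
  \<comment> \<open>Exponents above \<open>L\<close> are used as well, so the largest
    \<open>h\<close> with \<open>n * h < p ^ k * j\<close> may exceed \<open>i\<close> and is
    capped.\<close>
  define f where "f k = min i ((p ^ k * j - 1) div n)" for k
  have m: "2 * n \<le> m"
  proof -
    have "2 * n * 1 \<le> 2 * n * p ^ n" using assms(1) by (intro mult_le_mono2) simp
    then show ?thesis using assms(5) by linarith
  qed
  \<comment> \<open>Starting at \<open>n\<close> ensures \<open>n < p ^ k * j\<close>, so that
    \<open>h = 1\<close> satisfies the lower condition. The shift of the range to
    \<open>L + n\<close> costs a factor \<open>p ^ n\<close>, and \<open>i + 1 \<le> 2 * i\<close> a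
    factor 2; the bound on \<open>m\<close> absorbs both.\<close>
  have sub: "(\<lambda>k. (f k, k)) ` {n..L + n} \<subseteq> interval_pairs p m n i j"
  proof clarify
    fix k assume k: "k \<in> {n..L + n}"
    define x where "x = p ^ k * j"
    define q where "q = (x - 1) div n"
    have nx: "n < x" using less_power_mult[OF assms(1,2), of k] k by (simp add: x_def)
    have "x \<le> p ^ (L + n) * j"
      unfolding x_def using k assms(1) by (intro mult_le_mono1 power_increasing) auto
    also have "\<dots> = p ^ n * (p ^ L * j)" by (simp add: power_add)
    also have "\<dots> \<le> p ^ n * (n * (i + 1))" using 2(2) by (rule mult_le_mono2)
    also have "\<dots> \<le> p ^ n * (n * (2 * i))" using assms(4) by (intro mult_le_mono2) simp
    also have "\<dots> = 2 * n * p ^ n * i" by simp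
    also have "\<dots> \<le> m * i" using assms(5) by (rule mult_le_mono1)
    finally have xi: "x \<le> m * i" .
    have q1: "1 \<le> q" using nx assms(3) by (simp add: q_def Suc_le_eq div_greater_zero_iff)
    have "n * q \<le> x - 1" by (simp add: q_def)
    then have nq: "n * q < x" using nx by linarith
    have "x - 1 < n * (q + 1)"
      unfolding q_def using assms(3) dividend_less_div_times[of n "x - 1"]
      by (simp add: algebra_simps)
    then have "x \<le> n * (q + 1)" by linarith
    also have "\<dots> \<le> n * (2 * q)" using q1 by (intro mult_le_mono2) simp
    also have "\<dots> = 2 * n * q" by simp
    also have "\<dots> \<le> m * q" using m by (rule mult_le_mono1)
    finally have xq: "x \<le> m * q" .
    have "n * min i q \<le> n * q" by simp
    then have "n * min i q < x" using nq by linarith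
    moreover have "x \<le> m * min i q" using xi xq by (simp add: min_def)
    moreover have "f k = min i q" by (simp add: f_def q_def x_def)
    ultimately show "(f k, k) \<in> interval_pairs p m n i j"
      using q1 assms(4) by (simp add: interval_pairs_def x_def[symmetric])
  qed
  have "L + 1 = card ((\<lambda>k. (f k, k)) ` {n..L + n})"
    by (subst card_image) (auto simp: inj_on_def)
  also have "\<dots> \<le> card (interval_pairs p m n i j)"
    using sub by (intro card_mono finite_interval_pairs assms)
  finally show ?thesis using 2(1) by simp
qed simp

section \<open>Failure for large primes, part (ii)\<close>

lemma interval_pairs_one_eq_empty:
  assumes "0 < n" "m * i < p"
  shows "interval_pairs p m n i 1 = {}"
proof -
  \<comment> \<open>The power \<open>p ^ 0 = 1\<close> is too small to exceed \<open>n * h\<close>,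
    and every higher power is at least \<open>p > m * i \<ge> m * h\<close>.\<close>
  have False if hk: "1 \<le> h" "h \<le> i" "n * h < p ^ k" "p ^ k \<le> m * h" for h k
  proof (cases k)
    case 0
    then show False using hk(1,3) assms(1) by simp
  next
    case (Suc l)
    have "m * h \<le> m * i" using hk(2) by (rule mult_le_mono2)
    then have "p ^ k < p" using hk(4) assms(2) by linarith
    moreover have "p \<le> p ^ k" using assms(2) Suc by simp
    ultimately show False by simp
  qed
  then show ?thesis by (auto simp: interval_pairs_def)
qed

lemma s_p_one_pos:
  assumes "1 < p" "0 < n"
  shows "0 < s_p p n i 1"
proof -
  have "0 \<in> {k. p ^ k * 1 \<le> n * (i + 1)}" using assms by simp
  then show ?thesis
    unfolding s_p_eq_card[OF assms(1) zero_less_one] card_gt_0_iff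
    using finite_powers_le[OF assms(1) zero_less_one] by blast
qed

theorem theorem6p3:
  fixes \<alpha> :: "nat \<Rightarrow> nat \<Rightarrow> nat \<Rightarrow> nat \<Rightarrow> (nat \<Rightarrow> nat \<Rightarrow> int)"
  assumes alpha: "\<And>p m n i. prime p \<Longrightarrow> 1 < n \<Longrightarrow> n < m \<Longrightarrow> is_alpha p m n i (\<alpha> p m n i)"
  shows "(\<forall>p m n. prime p \<and> m > n \<and> n > 1 \<longrightarrow>
            (\<exists>i0. \<forall>i\<ge>i0. div_ge p (div_elem p (\<alpha> p m n i)) (div_Witt_trunc p n i)))
       \<and> (\<forall>m n. m > n \<and> n > 1 \<longrightarrow>
            filterlim
              (\<lambda>p. LEAST i0. \<forall>i\<ge>i0. div_ge p (div_elem p (\<alpha> p m n i)) (div_Witt_trunc p n i))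
              at_top (inf at_top (principal {p. prime p})))
       \<and> (\<forall>p n. prime p \<and> n > 1 \<longrightarrow>
            (\<exists>m0. \<forall>m\<ge>m0. \<forall>i>0.
               div_ge p (div_elem p (\<alpha> p m n i)) (div_Witt_trunc p n i)))"
proof -
  let ?G = "\<lambda>p m n i. div_ge p (div_elem p (\<alpha> p m n i)) (div_Witt_trunc p n i)"
  have iff: "?G p m n i \<longleftrightarrow> (\<forall>j\<in>I_p p. s_p p n i j \<le> card (interval_pairs p m n i j))"
    if "prime p" "1 < n" "n < m" for p m n i
    using div_ge_alpha_iff[OF that(1,3) alpha[OF that]] .
  have ex: "\<exists>i0. \<forall>i\<ge>i0. ?G p m n i" if *: "prime p" "1 < n" "n < m" for p m n
    using s_p_le_card_interval_pairs_large_i[of p _ n m] * prime_gt_1_nat[OF *(1)]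
    by (intro exI[of _ "p * (n * m * (1 + n * m))"]) (auto simp: iff I_p_def)
  moreover have "filterlim (\<lambda>p. LEAST i0. \<forall>i\<ge>i0. ?G p m n i) at_top
      (inf at_top (principal {p. prime p}))" if mn: "1 < n" "n < m" for m n
    unfolding filterlim_at_top eventually_inf_principal eventually_at_top_linorder
  \<comment> \<open>The wildcard becomes \<open>M\<close>: for a prime above \<open>m * M\<close>
    the inequality fails at \<open>i = M\<close> in the component \<open>j = 1\<close>.\<close>
  proof (intro allI exI[of _ "m * _ + 1"] impI)
    fix M p assume p: "m * M + 1 \<le> p" "p \<in> {p. prime p}"
    then have pr: "prime p" by simp
    have p1: "1 < p" using pr by (rule prime_gt_1_nat)
    have "\<not> ?G p m n M"
    proof
      assume "?G p m n M"
      moreover have "1 \<in> I_p p" using p1 by (simp add: I_p_def)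
      ultimately have "s_p p n M 1 \<le> card (interval_pairs p m n M 1)"
        using iff[OF pr mn] by blast
      also have "interval_pairs p m n M 1 = {}"
        using mn p(1) by (intro interval_pairs_one_eq_empty) auto
      finally show False using s_p_one_pos[OF p1, of n M] mn by simp
    qed
    \<comment> \<open>Part (i) guarantees that \<open>LEAST\<close> picks a genuine threshold; the
      failure at \<open>M\<close> then forces it past \<open>M\<close>.\<close>
    moreover have "\<forall>i\<ge>(LEAST i0. \<forall>i\<ge>i0. ?G p m n i). ?G p m n i"
      using ex[OF pr mn] by (rule LeastI_ex)
    ultimately show "M \<le> (LEAST i0. \<forall>i\<ge>i0. ?G p m n i)" using nat_le_linear by blast
  qed
  moreover have "\<exists>m0. \<forall>m\<ge>m0. \<forall>i>0. ?G p m n i" if pn: "prime p" "1 < n" for p n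
  proof (intro exI[of _ "2 * n * p ^ n"] allI impI)
    fix m i :: nat assume m: "2 * n * p ^ n \<le> m" and i: "0 < i"
    have p1: "1 < p" using pn(1) by (rule prime_gt_1_nat)
    \<comment> \<open>The assumption \<open>alpha\<close> speaks only of \<open>n < m\<close>, so
      the choice of \<open>m0\<close> has to ensure this too.\<close>
    have "2 * n * 1 \<le> 2 * n * p ^ n" using p1 by (intro mult_le_mono2) simp
    then have "n < m" using m pn(2) by linarith
    then show "?G p m n i"
      using s_p_le_card_interval_pairs_large_m[OF p1 _ _ i m] pn by (auto simp: iff I_p_def)
  qed
  ultimately show ?thesis by blast
qed

end
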